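(* Let $\lambda$ be a partition and let $$W_\lambda=\left\{\boldsymbol{s}=(s_{ij})\in T(\lambda,\mathbb{C})\ :\ \Re(s_{ij})\ge1\text{ for all }(i,j)\in D(\lambda)\setminus C(\lambda),\ \ \Re(s_{ij})>1\text{ for all }(i,j)\in C(\lambda)\right\}.$$ Then the series $$\zeta_\lambda(\boldsymbol{s})=\sum_{(m_{ij})\in\mathrm{SSYT}(\lambda)}\ \prod_{(i,j)\in D(\lambda)}\frac{1}{m_{ij}^{s_{ij}}}$$ converges absolutely if $\boldsymbol{s}\in W_\lambda$.
   Context: For a partition $\lambda=(\lambda_1\ge\cdots\ge\lambda_r>0)$, $D(\lambda)=\{(i,j):1\le i\le r,\ 1\le j\le\lambda_i\}$ is its Young diagram and $C(\lambda)$ is the set of corners, i.e. of $(i,j)\in D(\lambda)$ with $(i+1,j)\notin D(\lambda)$ and $(i,j+1)\notin D(\lambda)$. $T(\lambda,X)$ is the set of fillings of $D(\lambda)$ by elements of $X$. $\mathrm{SSYT}(\lambda)$ is the set of semi-standard Young tableaux: fillings of $D(\lambda)$ by positive integers with rows weakly increasing from left to right and columns strictly increasing from top to bottom. *)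

theory Defs
  imports "HOL-Analysis.Analysis"
begin

text \<open>A partition is the list of its parts; the empty partition \<open>[]\<close> is allowed.\<close>

definition is_partition :: "nat list \<Rightarrow> bool" where
  "is_partition lam \<longleftrightarrow> sorted_wrt (\<ge>) lam \<and> (\<forall>k\<in>set lam. 0 < k)"

text \<open>Cells \<open>(i, j)\<close> (row, column) are indexed from 1, so the \<open>i\<close>-th part is \<open>lam ! (i - 1)\<close>.\<close>

definition diagram :: "nat list \<Rightarrow> (nat \<times> nat) set" where
  "diagram lam = {(i, j). 1 \<le> i \<and> i \<le> length lam \<and> 1 \<le> j \<and> j \<le> lam ! (i - 1)}"

definition corners :: "nat list \<Rightarrow> (nat \<times> nat) set" where
  "corners lam =
     {(i, j) \<in> diagram lam. (i + 1, j) \<notin> diagram lam \<and> (i, j + 1) \<notin> diagram lam}"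

text \<open>
  The extensional function space makes a filling determined by its values on the diagram,
  so that a sum over fillings counts each of them exactly once.
\<close>

definition fillings :: "nat list \<Rightarrow> 'a set \<Rightarrow> (nat \<times> nat \<Rightarrow> 'a) set" where
  "fillings lam X = diagram lam \<rightarrow>\<^sub>E X"

definition SSYT :: "nat list \<Rightarrow> (nat \<times> nat \<Rightarrow> nat) set" where
  "SSYT lam =
     {m \<in> fillings lam {k. 0 < k}.
        (\<forall>i j j'. (i, j) \<in> diagram lam \<and> (i, j') \<in> diagram lam \<and> j < j'
            \<longrightarrow> m (i, j) \<le> m (i, j')) \<and>
        (\<forall>i i' j. (i, j) \<in> diagram lam \<and> (i', j) \<in> diagram lam \<and> i < i'
            \<longrightarrow> m (i, j) < m (i', j))}"

definition W :: "nat list \<Rightarrow> (nat \<times> nat \<Rightarrow> complex) set" where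
  "W lam =
     {s \<in> fillings lam UNIV.
        (\<forall>c \<in> diagram lam - corners lam. Re (s c) \<ge> 1) \<and>
        (\<forall>c \<in> corners lam. Re (s c) > 1)}"

definition schur_zeta_term ::
    "nat list \<Rightarrow> (nat \<times> nat \<Rightarrow> complex) \<Rightarrow> (nat \<times> nat \<Rightarrow> nat) \<Rightarrow> complex" where
  "schur_zeta_term lam s m = (\<Prod>c\<in>diagram lam. 1 / (of_nat (m c) powr s c))"

end

theory Submission
  imports Defs
begin

text \<open>
  In a semi-standard tableau every entry is bounded by the entry at some corner
  (\<open>SSYT_le_corner_entry\<close>), so the extra decay that the corners provide can be shared among
  all cells. Choose \<open>\<epsilon> > 0\<close> with \<open>Re (s k) \<ge> 1 + \<epsilon>\<close> at every corner \<open>k\<close>, and let \<open>N\<close> be the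
  number of cells. Every entry is at most the product \<open>P\<close> of the corner entries, so
  \<open>(\<Prod>c. m c) powr (\<epsilon> / N) \<le> P powr \<epsilon>\<close>; the surplus factor \<open>P powr - \<epsilon>\<close> in the
  term of the series can therefore be traded for a surplus \<open>\<epsilon> / N\<close> in the exponent of
  every cell (\<open>prod_powr_le_spread_excess\<close>). The resulting bound
  \<open>\<Prod>c. m c powr - (1 + \<epsilon> / N)\<close> is summable even over arbitrary fillings by positive
  integers, where its sum factors into \<open>N\<close> copies of the convergent series for
  \<open>\<zeta> (1 + \<epsilon> / N)\<close> (\<open>prod_powr_abs_summable_on_PiE\<close>).
\<close>

lemma finite_diagram: "finite (diagram lam)"
proof -
  have "diagram lam = Sigma {1..length lam} (\<lambda>i. {1..lam ! (i - 1)})"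
    by (auto simp: diagram_def)
  then show ?thesis by simp
qed

lemma corners_subset_diagram: "corners lam \<subseteq> diagram lam"
  by (auto simp: corners_def)

text \<open>
  Among the cells whose entry is at least \<open>m c\<close>, one with \<open>i + j\<close> maximal is a corner: a cell
  to the right of it or below it would have an entry at least as large.
\<close>

lemma SSYT_le_corner_entry:
  assumes m: "m \<in> SSYT lam" and c: "c \<in> diagram lam"
  obtains k where "k \<in> corners lam" "m c \<le> m k"
proof -
  define S where "S = {d \<in> diagram lam. m c \<le> m d}"
  have "finite S" "c \<in> S"
    using c finite_diagram by (auto simp: S_def)
  then have "Max ((\<lambda>d. fst d + snd d) ` S) \<in> (\<lambda>d. fst d + snd d) ` S"
    by (intro Max_in) auto
  then obtain i j where ij: "(i, j) \<in> S"
    and max: "i + j = Max ((\<lambda>d. fst d + snd d) ` S)"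
    by auto
  have le: "i' + j' \<le> i + j" if "(i', j') \<in> S" for i' j'
  proof -
    have "fst (i', j') + snd (i', j') \<le> Max ((\<lambda>d. fst d + snd d) ` S)"
      using that \<open>finite S\<close> by (intro Max_ge finite_imageI imageI)
    then show ?thesis by (simp add: max)
  qed
  have "(i + 1, j) \<notin> diagram lam"
  proof
    assume d: "(i + 1, j) \<in> diagram lam"
    then have "m (i, j) < m (i + 1, j)"
      using m ij unfolding SSYT_def S_def by auto
    then have "(i + 1, j) \<in> S" using d ij by (auto simp: S_def)
    then show False using le by fastforce
  qed
  moreover have "(i, j + 1) \<notin> diagram lam"
  proof
    assume d: "(i, j + 1) \<in> diagram lam"
    then have "m (i, j) \<le> m (i, j + 1)"
      using m ij unfolding SSYT_def S_def by auto
    then have "(i, j + 1) \<in> S" using d ij by (auto simp: S_def)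
    then show False using le by fastforce
  qed
  ultimately have "(i, j) \<in> corners lam"
    using ij by (auto simp: corners_def S_def)
  then show thesis using that ij by (auto simp: S_def)
qed

text \<open>
  Each \<open>a c\<close> is at most \<open>P = (\<Prod>k\<in>K. a k)\<close>, so the \<open>N = card D\<close> factors
  \<open>a c powr (\<epsilon> / N)\<close> together cost at most the surplus \<open>P powr \<epsilon>\<close> that \<open>K\<close> provides.
\<close>

lemma prod_powr_le_spread_excess:
  fixes a \<sigma> :: "'a \<Rightarrow> real"
  assumes "finite D" "K \<subseteq> D" "0 \<le> \<epsilon>"
    and a: "\<And>c. c \<in> D \<Longrightarrow> 1 \<le> a c"
    and dominated: "\<And>c. c \<in> D \<Longrightarrow> \<exists>k\<in>K. a c \<le> a k"
    and \<sigma>: "\<And>c. c \<in> D \<Longrightarrow> 1 \<le> \<sigma> c"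
    and \<sigma>_K: "\<And>k. k \<in> K \<Longrightarrow> 1 + \<epsilon> \<le> \<sigma> k"
  shows "(\<Prod>c\<in>D. a c powr - \<sigma> c) \<le> (\<Prod>c\<in>D. a c powr - (1 + \<epsilon> / card D))"
proof (cases "D = {}")
  case False
  define N where "N = real (card D)"
  define P where "P = (\<Prod>k\<in>K. a k)"
  have "N > 0"
    using False \<open>finite D\<close> by (simp add: N_def card_gt_0_iff)
  have "finite K" using assms finite_subset by blast
  have aK: "1 \<le> a k" if "k \<in> K" for k using a that \<open>K \<subseteq> D\<close> by blast
  have "P > 0"
    unfolding P_def using aK by (intro prod_pos) force
  have a_le_P: "a c \<le> P" if "c \<in> D" for c
  proof -
    obtain k where k: "k \<in> K" "a c \<le> a k" using dominated \<open>c \<in> D\<close> by blast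
    have "a k = (\<Prod>l\<in>{k}. a l)" by simp
    also have "\<dots> \<le> P"
      unfolding P_def using k \<open>finite K\<close> aK by (intro prod_mono2) force+
    finally show ?thesis using k by simp
  qed
  have "(\<Prod>c\<in>D. a c powr (\<epsilon> / N)) \<le> (\<Prod>c\<in>D. P powr (\<epsilon> / N))"
  proof (intro prod_mono conjI powr_mono2)
    show "0 \<le> a c" if "c \<in> D" for c using a[OF that] by simp
  qed (use a_le_P \<open>0 \<le> \<epsilon>\<close> \<open>N > 0\<close> in auto)
  also have "\<dots> = P powr \<epsilon>"
    using \<open>P > 0\<close> \<open>N > 0\<close> by (simp add: powr_power N_def)
  finally have spread: "(\<Prod>c\<in>D. a c powr (\<epsilon> / N)) \<le> P powr \<epsilon>" .
  have "(\<Prod>c\<in>D. a c powr - \<sigma> c)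
      \<le> (\<Prod>c\<in>D. a c powr - 1 * (if c \<in> K then a c powr - \<epsilon> else 1))"
  proof (intro prod_mono conjI)
    fix c assume "c \<in> D"
    have "a c powr - \<sigma> c \<le> a c powr (- 1 + (if c \<in> K then - \<epsilon> else 0))"
      using a[OF \<open>c \<in> D\<close>] \<sigma>[OF \<open>c \<in> D\<close>] \<sigma>_K[of c] by (intro powr_mono) auto
    also have "\<dots> = a c powr - 1 * (if c \<in> K then a c powr - \<epsilon> else 1)"
      using a[OF \<open>c \<in> D\<close>] unfolding powr_add by auto
    finally show "a c powr - \<sigma> c \<le> a c powr - 1 * (if c \<in> K then a c powr - \<epsilon> else 1)" .
  qed simp
  also have "\<dots> = (\<Prod>c\<in>D. a c powr - 1) * (\<Prod>k\<in>K. a k powr - \<epsilon>)"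
    unfolding prod.distrib using \<open>finite D\<close> \<open>K \<subseteq> D\<close>
    by (simp add: prod.inter_restrict[symmetric] Int_absorb1)
  also have "(\<Prod>k\<in>K. a k powr - \<epsilon>) = P powr - \<epsilon>"
    unfolding P_def by (rule prod_powr_distrib[symmetric])
  also have "(\<Prod>c\<in>D. a c powr - 1) * P powr - \<epsilon>
      \<le> (\<Prod>c\<in>D. a c powr - 1) * inverse (\<Prod>c\<in>D. a c powr (\<epsilon> / N))"
  proof (intro mult_left_mono prod_nonneg)
    have "0 < (\<Prod>c\<in>D. a c powr (\<epsilon> / N))"
      using a by (intro prod_pos) force
    then show "P powr - \<epsilon> \<le> inverse (\<Prod>c\<in>D. a c powr (\<epsilon> / N))"
      using spread by (simp add: powr_minus le_imp_inverse_le)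
  qed simp
  also have "\<dots> = (\<Prod>c\<in>D. a c powr - (1 + \<epsilon> / N))"
    unfolding prod_inversef[symmetric] prod.distrib[symmetric] minus_add_distrib powr_add
    by (simp only: o_def powr_minus)
  finally show ?thesis by (simp add: N_def)
qed simp

lemma prod_powr_abs_summable_on_PiE:
  fixes \<tau> :: real
  assumes "finite D" "\<tau> > 1"
  shows "Infinite_Sum.abs_summable_on
           (\<lambda>m. \<Prod>c\<in>D. real (m c) powr - \<tau>) (D \<rightarrow>\<^sub>E {n. 0 < n})"
proof -
  have "(\<lambda>n. real n powr - \<tau>) summable_on {n. 0 < n}"
  proof (rule summable_on_subset_banach)
    have "summable (\<lambda>n. real n powr - \<tau>)"
      using \<open>\<tau> > 1\<close> by (subst summable_real_powr_iff) simp
    then show "(\<lambda>n. real n powr - \<tau>) summable_on UNIV"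
      by (subst summable_on_UNIV_nonneg_real_iff) auto
  qed simp
  then have "Infinite_Set_Sum.abs_summable_on (\<lambda>n. real n powr - \<tau>) {n. 0 < n}"
    unfolding abs_summable_equivalent[symmetric] by simp
  then show ?thesis
    unfolding abs_summable_equivalent using \<open>finite D\<close>
    by (intro abs_summable_on_prod_PiE) auto
qed

lemma norm_schur_zeta_term:
  assumes "m \<in> SSYT lam"
  shows "norm (schur_zeta_term lam s m) = (\<Prod>c\<in>diagram lam. real (m c) powr - Re (s c))"
  unfolding schur_zeta_term_def prod_norm[symmetric]
proof (rule prod.cong)
  fix c assume "c \<in> diagram lam"
  then have "0 < m c" using assms by (auto simp: SSYT_def fillings_def)
  then show "norm (1 / of_nat (m c) powr s c) = real (m c) powr - Re (s c)"
    by (simp add: norm_divide norm_powr_real_powr powr_minus_divide)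
qed simp

theorem lemma2p1:
  fixes lam :: "nat list" and s :: "nat \<times> nat \<Rightarrow> complex"
  assumes "is_partition lam"
    and "s \<in> W lam"
  shows "Infinite_Sum.abs_summable_on (schur_zeta_term lam s) (SSYT lam)"
proof (cases "diagram lam = {}")
  case True
  \<comment> \<open>Here \<open>\<epsilon> / N\<close> would be 0, which leaves no surplus; but there is only one filling.\<close>
  then have "SSYT lam \<subseteq> {\<lambda>_. undefined}"
    by (auto simp: SSYT_def fillings_def)
  then show ?thesis by (meson finite.intros finite_subset summable_on_finite)
next
  case False
  define N where "N = card (diagram lam)"
  have "N > 0" using False by (simp add: N_def card_gt_0_iff finite_diagram)
  have fin: "finite (corners lam)"
    using finite_diagram corners_subset_diagram by (rule rev_finite_subset)
  have W: "1 \<le> Re (s c)" if "c \<in> diagram lam" for c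
    using assms(2) that unfolding W_def by fastforce
  have W_corner: "1 < Re (s k)" if "k \<in> corners lam" for k
    using assms(2) that unfolding W_def by blast
  \<comment> \<open>The extra element 1 spares a proof that corners exist, and keeps the minimum positive.\<close>
  define \<epsilon> where "\<epsilon> = Min (insert 1 ((\<lambda>k. Re (s k) - 1) ` corners lam))"
  have "\<epsilon> > 0" using fin W_corner by (simp add: \<epsilon>_def)
  have excess: "1 + \<epsilon> \<le> Re (s k)" if "k \<in> corners lam" for k
  proof -
    have "\<epsilon> \<le> Re (s k) - 1" unfolding \<epsilon>_def using fin that by (intro Min_le) auto
    then show ?thesis by simp
  qed
  have subset: "SSYT lam \<subseteq> diagram lam \<rightarrow>\<^sub>E {n. 0 < n}"
    by (auto simp: SSYT_def fillings_def)
  show ?thesis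
  proof (rule Infinite_Sum.abs_summable_on_comparison_test)
    show "Infinite_Sum.abs_summable_on
        (\<lambda>m. \<Prod>c\<in>diagram lam. real (m c) powr - (1 + \<epsilon> / N)) (SSYT lam)"
      by (rule summable_on_subset_banach[OF prod_powr_abs_summable_on_PiE subset])
        (use \<open>\<epsilon> > 0\<close> \<open>N > 0\<close> finite_diagram in auto)
    fix m assume m: "m \<in> SSYT lam"
    have "norm (schur_zeta_term lam s m) = (\<Prod>c\<in>diagram lam. real (m c) powr - Re (s c))"
      by (rule norm_schur_zeta_term[OF m])
    also have "\<dots> \<le> (\<Prod>c\<in>diagram lam. real (m c) powr - (1 + \<epsilon> / N))"
      unfolding N_def
    proof (rule prod_powr_le_spread_excess[OF finite_diagram corners_subset_diagram])
      show "1 \<le> real (m c)" if "c \<in> diagram lam" for c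
        using m that subset by (force simp: Suc_le_eq)
      show "\<exists>k\<in>corners lam. real (m c) \<le> real (m k)" if "c \<in> diagram lam" for c
        using SSYT_le_corner_entry[OF m that] by (metis of_nat_mono)
    qed (use \<open>\<epsilon> > 0\<close> W excess in auto)
    also have "\<dots> = norm (\<Prod>c\<in>diagram lam. real (m c) powr - (1 + \<epsilon> / N))"
      by (simp add: prod_nonneg)
    finally show "norm (schur_zeta_term lam s m)
        \<le> norm (\<Prod>c\<in>diagram lam. real (m c) powr - (1 + \<epsilon> / N))" .
  qed
qed

end
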